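(* Let $\mathbf X=(X,\lambda_X,\rho_X)$ and $\mathbf Y=(Y,\lambda_Y,\rho_Y)$ be topological unosemigroups and let $I\subset X$ be a closed two-sided ideal of $X$ with $\lambda_X(I)\cup\rho_X(I)\subset I$. If $\mathbf X$ and $\mathbf Y$ are ditopological unosemigroups, then so is their reduced product $\mathbf X\times_I\mathbf Y=(X\times_I Y,\lambda,\rho)$.
   Context: A topological semigroup is a non-empty topological space $S$ endowed with a continuous associative binary operation $\cdot:S\times S\to S$. A left (resp. right) unit operation on $S$ is a map $\lambda:S\to S$ with $\lambda(x)\cdot x=x$ (resp. a map $\rho:S\to S$ with $x\cdot\rho(x)=x$) for all $x\in S$. A topological unosemigroup $(S,\lambda,\rho)$ is a topological semigroup $S$ with a continuous left unit operation $\lambda$ and a continuous right unit operation $\rho$. For $A,B\subset S$ put $A\leftthreetimes B=\{x\in S: ax\in B \text{ for some } a\in A\}$ and $B\rightthreetimes A=\{x\in S: xa\in B\text{ for some }a\in A\}$. A continuous left unit operation $\lambda$ is dicontinuous if for every $x\in S$ and every neighborhood $O_x\subset S$ of $x$ there are a neighborhood $U_x\subset S$ of $x$ and a neighborhood $W_{\lambda(x)}\subset\lambda(S)$ of $\lambda(x)$ in the subspace $\lambda(S)$ such that $(W_{\lambda(x)}\leftthreetimes U_x)\cap\lambda^{-1}(W_{\lambda(x)})\subset O_x$. A continuous right unit operation $\rho$ is dicontinuous if for every $x\in S$ and every neighborhood $O_x\subset S$ of $x$ there are a neighborhood $U_x\subset S$ of $x$ and a neighborhood $W_{\rho(x)}\subset\rho(S)$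 of $\rho(x)$ in the subspace $\rho(S)$ such that $(U_x\rightthreetimes W_{\rho(x)})\cap\rho^{-1}(W_{\rho(x)})\subset O_x$. A topological unosemigroup is ditopological if both $\lambda$ and $\rho$ are dicontinuous. Reduced product: for topological semigroups $X,Y$ and a closed two-sided ideal $I\subset X$, $X\times_I Y$ is the set $I\cup((X\setminus I)\times Y)$ with the smallest topology such that the inclusion $(X\setminus I)\times Y\hookrightarrow X\times_I Y$ is a topological embedding and the projection $\pi:X\times_I Y\to X$, $\pi(z)=z$ for $z\in I$ and $\pi(x,y)=x$ for $(x,y)\in(X\setminus I)\times Y$, is continuous. Its semigroup operation is the unique binary operation making the map $q:X\times Y\to X\times_I Y$, $q(x,y)=x$ if $x\in I$ and $q(x,y)=(x,y)$ otherwise, a semigroup homomorphism. If $\lambda_X(I)\cup\rho_X(I)\subset I$, the unit operations on $X\times_I Y$ are $\lambda(z)=\lambda_X(z)$, $\rho(z)=\rho_X(z)$ for $z\in I$, and $\lambda(x,y)=(\lambda_X(x),\lambda_Y(y))$, $\rho(x,y)=(\rho_X(x),\rho_Y(y))$ for $(x,y)\in(X\setminus I)\times Y$; $(X\times_I Y,\lambda,\rho)$ is a topological unosemigroup. *)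

theory Defs
  imports "HOL-Analysis.Analysis"
begin

section \<open>Ditopological unosemigroups\<close>

text \<open>
  Spaces are given as values of type \<open>'a topology\<close>; the algebraic operations are total functions
  whose values outside the carrier are irrelevant.
\<close>

locale topological_semigroup =
  fixes S :: "'a topology" and m :: "'a \<Rightarrow> 'a \<Rightarrow> 'a"
  assumes nonempty: "topspace S \<noteq> {}"
    and continuous_mult: "continuous_map (prod_topology S S) S (\<lambda>(x, y). m x y)"
    and assoc: "\<And>x y z. \<lbrakk>x \<in> topspace S; y \<in> topspace S; z \<in> topspace S\<rbrakk>
                  \<Longrightarrow> m (m x y) z = m x (m y z)"

locale topological_unosemigroup = topological_semigroup S m
  for S :: "'a topology" and m :: "'a \<Rightarrow> 'a \<Rightarrow> 'a" +
  fixes lu :: "'a \<Rightarrow> 'a" and ru :: "'a \<Rightarrow> 'a"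
  assumes continuous_lu: "continuous_map S S lu"
    and continuous_ru: "continuous_map S S ru"
    and left_unit: "\<And>x. x \<in> topspace S \<Longrightarrow> m (lu x) x = x"
    and right_unit: "\<And>x. x \<in> topspace S \<Longrightarrow> m x (ru x) = x"

definition left_quot :: "'a topology \<Rightarrow> ('a \<Rightarrow> 'a \<Rightarrow> 'a) \<Rightarrow> 'a set \<Rightarrow> 'a set \<Rightarrow> 'a set" where
  "left_quot S m A B = {x \<in> topspace S. \<exists>a\<in>A. m a x \<in> B}"

definition right_quot :: "'a topology \<Rightarrow> ('a \<Rightarrow> 'a \<Rightarrow> 'a) \<Rightarrow> 'a set \<Rightarrow> 'a set \<Rightarrow> 'a set" where
  "right_quot S m B A = {x \<in> topspace S. \<exists>a\<in>A. m x a \<in> B}"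

text \<open>
  Neighborhoods are taken to be open. The conditions are monotone in the sets involved, so admitting
  arbitrary neighborhoods would give the same notions.
\<close>

definition dicontinuous_left :: "'a topology \<Rightarrow> ('a \<Rightarrow> 'a \<Rightarrow> 'a) \<Rightarrow> ('a \<Rightarrow> 'a) \<Rightarrow> bool" where
  "dicontinuous_left S m lu \<longleftrightarrow>
     (\<forall>x\<in>topspace S. \<forall>O'. openin S O' \<and> x \<in> O' \<longrightarrow>
        (\<exists>U W. openin S U \<and> x \<in> U \<and>
               openin (subtopology S (lu ` topspace S)) W \<and> lu x \<in> W \<and>
               left_quot S m W U \<inter> {z \<in> topspace S. lu z \<in> W} \<subseteq> O'))"

definition dicontinuous_right :: "'a topology \<Rightarrow> ('a \<Rightarrow> 'a \<Rightarrow> 'a) \<Rightarrow> ('a \<Rightarrow> 'a) \<Rightarrow> bool" where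
  "dicontinuous_right S m ru \<longleftrightarrow>
     (\<forall>x\<in>topspace S. \<forall>O'. openin S O' \<and> x \<in> O' \<longrightarrow>
        (\<exists>U W. openin S U \<and> x \<in> U \<and>
               openin (subtopology S (ru ` topspace S)) W \<and> ru x \<in> W \<and>
               right_quot S m U W \<inter> {z \<in> topspace S. ru z \<in> W} \<subseteq> O'))"

locale ditopological_unosemigroup = topological_unosemigroup S m lu ru
  for S :: "'a topology" and m :: "'a \<Rightarrow> 'a \<Rightarrow> 'a"
    and lu :: "'a \<Rightarrow> 'a" and ru :: "'a \<Rightarrow> 'a" +
  assumes dicontinuous_lu: "dicontinuous_left S m lu"
    and dicontinuous_ru: "dicontinuous_right S m ru"

text \<open>Following the bare inclusions, the empty set counts as an ideal.\<close>

definition two_sided_ideal :: "'a topology \<Rightarrow> ('a \<Rightarrow> 'a \<Rightarrow> 'a) \<Rightarrow> 'a set \<Rightarrow> bool" where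
  "two_sided_ideal S m I \<longleftrightarrow>
     I \<subseteq> topspace S \<and> (\<forall>x\<in>topspace S. \<forall>i\<in>I. m x i \<in> I \<and> m i x \<in> I)"

section \<open>Reduced products\<close>

text \<open>
  The union of \<open>I\<close> and \<open>(X - I) \<times> Y\<close> is understood to be disjoint and is
  represented inside the sum type \<open>'a + 'a \<times> 'b\<close>.
\<close>

definition reduced_carrier ::
    "'a topology \<Rightarrow> 'b topology \<Rightarrow> 'a set \<Rightarrow> ('a + 'a \<times> 'b) set" where
  "reduced_carrier X Y I = I <+> (topspace X - I) \<times> topspace Y"

fun reduced_proj :: "'a + 'a \<times> 'b \<Rightarrow> 'a" where
  "reduced_proj (Inl z) = z"
| "reduced_proj (Inr (x, y)) = x"

definition reduced_quot :: "'a set \<Rightarrow> 'a \<times> 'b \<Rightarrow> 'a + 'a \<times> 'b" where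
  "reduced_quot I p = (if fst p \<in> I then Inl (fst p) else Inr p)"

definition reduced_admissible ::
    "'a topology \<Rightarrow> 'b topology \<Rightarrow> 'a set \<Rightarrow> ('a + 'a \<times> 'b) topology \<Rightarrow> bool" where
  "reduced_admissible X Y I T \<longleftrightarrow>
     topspace T = reduced_carrier X Y I \<and>
     embedding_map (prod_topology (subtopology X (topspace X - I)) Y) T Inr \<and>
     continuous_map T X reduced_proj"

text \<open>
  The intersection of all admissible topologies; by \<open>reduced_topology_least\<close> below it is
  itself admissible, hence the smallest admissible topology.
\<close>

definition reduced_topology ::
    "'a topology \<Rightarrow> 'b topology \<Rightarrow> 'a set \<Rightarrow> ('a + 'a \<times> 'b) topology" where
  "reduced_topology X Y I =
     topology (\<lambda>U. \<forall>T. reduced_admissible X Y I T \<longrightarrow> openin T U)"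

fun reduced_mult ::
    "'a set \<Rightarrow> ('a \<Rightarrow> 'a \<Rightarrow> 'a) \<Rightarrow> ('b \<Rightarrow> 'b \<Rightarrow> 'b) \<Rightarrow>
     'a + 'a \<times> 'b \<Rightarrow> 'a + 'a \<times> 'b \<Rightarrow> 'a + 'a \<times> 'b" where
  "reduced_mult I mX mY (Inl a) (Inl b) = Inl (mX a b)"
| "reduced_mult I mX mY (Inl a) (Inr (x, y)) = Inl (mX a x)"
| "reduced_mult I mX mY (Inr (x, y)) (Inl a) = Inl (mX x a)"
| "reduced_mult I mX mY (Inr (x, y)) (Inr (x', y')) = reduced_quot I (mX x x', mY y y')"

fun reduced_unit ::
    "('a \<Rightarrow> 'a) \<Rightarrow> ('b \<Rightarrow> 'b) \<Rightarrow> 'a + 'a \<times> 'b \<Rightarrow> 'a + 'a \<times> 'b" where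
  "reduced_unit uX uY (Inl z) = Inl (uX z)"
| "reduced_unit uX uY (Inr (x, y)) = Inr (uX x, uY y)"

subsection \<open>Well-definedness of the construction\<close>

lemma reduced_quot_image:
  assumes "I \<subseteq> topspace X" "topspace Y \<noteq> {}"
  shows "reduced_quot I ` (topspace X \<times> topspace Y) = reduced_carrier X Y I"
proof
  show "reduced_quot I ` (topspace X \<times> topspace Y) \<subseteq> reduced_carrier X Y I"
    by (auto simp: reduced_quot_def reduced_carrier_def)
  obtain y where y: "y \<in> topspace Y" using assms by blast
  show "reduced_carrier X Y I \<subseteq> reduced_quot I ` (topspace X \<times> topspace Y)"
  proof
    fix z assume "z \<in> reduced_carrier X Y I"
    then consider i where "z = Inl i" "i \<in> I"
      | p where "z = Inr p" "p \<in> (topspace X - I) \<times> topspace Y"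
      by (auto simp: reduced_carrier_def)
    then show "z \<in> reduced_quot I ` (topspace X \<times> topspace Y)"
    proof cases
      case 1
      then show ?thesis using y assms
        by (intro image_eqI[of _ _ "(i, y)"]) (auto simp: reduced_quot_def)
    next
      case 2
      then show ?thesis
        by (intro image_eqI[of _ _ p]) (auto simp: reduced_quot_def)
    qed
  qed
qed

lemma reduced_mult_hom:
  assumes "two_sided_ideal X mX I"
    and "p \<in> topspace X \<times> topspace Y" "p' \<in> topspace X \<times> topspace Y"
  shows "reduced_mult I mX mY (reduced_quot I p) (reduced_quot I p')
       = reduced_quot I (mX (fst p) (fst p'), mY (snd p) (snd p'))"
  using assms by (cases p; cases p') (auto simp: reduced_quot_def two_sided_ideal_def)

lemma reduced_mult_unique:
  assumes "two_sided_ideal X mX I" "topspace Y \<noteq> {}"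
    and hom: "\<And>p p'. \<lbrakk>p \<in> topspace X \<times> topspace Y; p' \<in> topspace X \<times> topspace Y\<rbrakk> \<Longrightarrow>
         f (reduced_quot I p) (reduced_quot I p')
       = reduced_quot I (mX (fst p) (fst p'), mY (snd p) (snd p'))"
    and "z \<in> reduced_carrier X Y I" "w \<in> reduced_carrier X Y I"
  shows "f z w = reduced_mult I mX mY z w"
proof -
  have "I \<subseteq> topspace X"
    using assms(1) by (simp add: two_sided_ideal_def)
  then obtain p p' where "p \<in> topspace X \<times> topspace Y" "p' \<in> topspace X \<times> topspace Y"
    "z = reduced_quot I p" "w = reduced_quot I p'"
    using assms(2,4,5) reduced_quot_image[of I X Y] by blast
  then show ?thesis
    using hom reduced_mult_hom[OF assms(1)] by metis
qed

lemma openin_reduced_topology: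
  "openin (reduced_topology X Y I) U \<longleftrightarrow> (\<forall>T. reduced_admissible X Y I T \<longrightarrow> openin T U)"
proof -
  have "istopology (\<lambda>U. \<forall>T. reduced_admissible X Y I T \<longrightarrow> openin T U)"
    unfolding istopology_def by blast
  then show ?thesis
    by (simp add: reduced_topology_def topology_inverse')
qed

context
  fixes X :: "'a topology" and Y :: "'b topology" and I :: "'a set"
  assumes closed: "closedin X I"
begin

private abbreviation "P \<equiv> prod_topology (subtopology X (topspace X - I)) Y"

private definition base_open :: "('a + 'a \<times> 'b) set \<Rightarrow> bool" where
  "base_open U \<longleftrightarrow> U \<subseteq> reduced_carrier X Y I \<and> openin P (Inr -` U) \<and>
     (\<forall>x\<in>I. Inl x \<in> U \<longrightarrow>
        (\<exists>V. openin X V \<and> x \<in> V \<and> {z \<in> reduced_carrier X Y I. reduced_proj z \<in> V} \<subseteq> U))"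

private lemma openin_base: "openin (topology base_open) U \<longleftrightarrow> base_open U"
proof -
  have "istopology base_open"
    unfolding istopology_def
  proof (intro conjI allI impI)
    fix U V assume UV: "base_open U" "base_open V"
    show "base_open (U \<inter> V)"
      unfolding base_open_def
    proof (intro conjI ballI impI)
      fix x assume x: "x \<in> I" "Inl x \<in> U \<inter> V"
      obtain G where "openin X G" "x \<in> G"
        "{z \<in> reduced_carrier X Y I. reduced_proj z \<in> G} \<subseteq> U"
        using UV x unfolding base_open_def by blast
      moreover obtain H where "openin X H" "x \<in> H"
        "{z \<in> reduced_carrier X Y I. reduced_proj z \<in> H} \<subseteq> V"
        using UV x unfolding base_open_def by blast
      ultimately show "\<exists>W. openin X W \<and> x \<in> W \<and>
          {z \<in> reduced_carrier X Y I. reduced_proj z \<in> W} \<subseteq> U \<inter> V"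
        by (intro exI[of _ "G \<inter> H"]) auto
    qed (use UV in \<open>auto simp: base_open_def vimage_Int\<close>)
  next
    fix \<U> assume \<U>: "\<forall>U\<in>\<U>. base_open U"
    show "base_open (\<Union>\<U>)"
      unfolding base_open_def
    proof (intro conjI ballI impI)
      show "openin P (Inr -` \<Union>\<U>)"
        using \<U> unfolding vimage_Union base_open_def by blast
    next
      fix x assume x: "x \<in> I" "Inl x \<in> \<Union>\<U>"
      then show "\<exists>W. openin X W \<and> x \<in> W \<and>
          {z \<in> reduced_carrier X Y I. reduced_proj z \<in> W} \<subseteq> \<Union>\<U>"
        using \<U> unfolding base_open_def by (meson Union_iff Union_upper subset_trans)
    qed (use \<U> in \<open>auto simp: base_open_def\<close>)
  qed
  then show ?thesis by (simp add: topology_inverse')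
qed

private lemma topspace_P: "topspace P = (topspace X - I) \<times> topspace Y"
  by auto

private lemma base_open_preimage:
  assumes "openin X V"
  shows "base_open {z \<in> reduced_carrier X Y I. reduced_proj z \<in> V}"
proof -
  have "openin (subtopology X (topspace X - I)) (V \<inter> (topspace X - I))"
    using assms by (rule openin_subtopology_Int)
  then have "openin P ((V \<inter> (topspace X - I)) \<times> topspace Y)"
    by (simp add: openin_prod_Times_iff)
  moreover have "Inr -` {z \<in> reduced_carrier X Y I. reduced_proj z \<in> V}
      = (V \<inter> (topspace X - I)) \<times> topspace Y"
    by (auto simp: reduced_carrier_def)
  ultimately show ?thesis
    using assms unfolding base_open_def by (auto simp del: openin_prod_Times_iff)
qed

private lemma topspace_base: "topspace (topology base_open) = reduced_carrier X Y I"
proof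
  show "topspace (topology base_open) \<subseteq> reduced_carrier X Y I"
    using openin_base openin_topspace base_open_def by metis
  have "{z \<in> reduced_carrier X Y I. reduced_proj z \<in> topspace X} = reduced_carrier X Y I"
    using closedin_subset[OF closed] by (auto simp: reduced_carrier_def)
  then show "reduced_carrier X Y I \<subseteq> topspace (topology base_open)"
    using base_open_preimage[OF openin_topspace] openin_base openin_subset by metis
qed

private lemma base_admissible: "reduced_admissible X Y I (topology base_open)"
proof -
  have "continuous_map P (topology base_open) Inr"
    unfolding continuous_map_def openin_base topspace_base
  proof (intro conjI allI impI)
    show "Inr \<in> topspace P \<rightarrow> reduced_carrier X Y I"
      by (auto simp: reduced_carrier_def)
    fix U assume U: "base_open U"
    then have "{x \<in> topspace P. Inr x \<in> U} = Inr -` U"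
      unfolding base_open_def using openin_subset by blast
    then show "openin P {x \<in> topspace P. Inr x \<in> U}"
      using U base_open_def by simp
  qed
  moreover have "open_map P (topology base_open) Inr"
    unfolding open_map_def openin_base
  proof (intro allI impI)
    fix W assume W: "openin P W"
    then have "W \<subseteq> (topspace X - I) \<times> topspace Y"
      using openin_subset topspace_P by blast
    moreover have "Inr -` (Inr ` W :: ('a + 'a \<times> 'b) set) = W" by auto
    ultimately show "base_open (Inr ` W)"
      using W by (auto simp: base_open_def reduced_carrier_def)
  qed
  ultimately have "embedding_map P (topology base_open) Inr"
    by (intro injective_open_imp_embedding_map) auto
  moreover have "continuous_map (topology base_open) X reduced_proj"
    unfolding continuous_map_def openin_base topspace_base
    using base_open_preimage closedin_subset[OF closed] by (auto simp: reduced_carrier_def)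
  ultimately show ?thesis
    by (simp add: reduced_admissible_def topspace_base)
qed

private lemma base_least:
  assumes T: "reduced_admissible X Y I T" and U: "base_open U"
  shows "openin T U"
proof -
  have cont: "continuous_map T X reduced_proj"
    and top: "topspace T = reduced_carrier X Y I"
    and emb: "embedding_map P T Inr"
    using T by (auto simp: reduced_admissible_def)
  have pre: "openin T {z \<in> reduced_carrier X Y I. reduced_proj z \<in> V}" if "openin X V" for V
    using cont that top unfolding continuous_map_def by auto
  have img: "Inr ` topspace P = {z \<in> reduced_carrier X Y I. reduced_proj z \<in> topspace X - I}"
    by (auto simp: reduced_carrier_def)
  have "openin X (topspace X - I)"
    using closed by blast
  then have op: "openin T (Inr ` topspace P)"
    unfolding img by (rule pre)
  have "open_map P (subtopology T (Inr ` topspace P)) Inr"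
    using emb unfolding embedding_map_def by (rule homeomorphic_imp_open_map)
  then have "openin (subtopology T (Inr ` topspace P)) (Inr ` (Inr -` U))"
    using U unfolding open_map_def base_open_def by blast
  then have right: "openin T (Inr ` (Inr -` U))"
    using op openin_trans_full by blast
  show ?thesis
  proof (subst openin_subopen, intro ballI)
    fix z assume z: "z \<in> U"
    show "\<exists>V. openin T V \<and> z \<in> V \<and> V \<subseteq> U"
    proof (cases z)
      case (Inr p)
      then show ?thesis using right z by blast
    next
      case (Inl x)
      then have x: "x \<in> I" and zc: "z \<in> reduced_carrier X Y I"
        using z U by (auto simp: base_open_def reduced_carrier_def)
      then obtain V where "openin X V" "x \<in> V"
          "{z \<in> reduced_carrier X Y I. reduced_proj z \<in> V} \<subseteq> U"
        using U z Inl unfolding base_open_def by blast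
      then show ?thesis using pre zc Inl
        by (intro exI[of _ "{z \<in> reduced_carrier X Y I. reduced_proj z \<in> V}"]) auto
    qed
  qed
qed

lemma reduced_topology_least:
  "reduced_admissible X Y I (reduced_topology X Y I)"
  "\<And>T U. reduced_admissible X Y I T \<Longrightarrow> openin (reduced_topology X Y I) U \<Longrightarrow> openin T U"
proof -
  have "reduced_topology X Y I = topology base_open"
    unfolding topology_eq openin_reduced_topology openin_base
    using base_admissible base_least openin_base by blast
  then show "reduced_admissible X Y I (reduced_topology X Y I)"
    using base_admissible by simp
qed (simp add: openin_reduced_topology)

end

end

(*
  A point z of the reduced product lying in I has the preimages, under the projection p, of the
  neighborhoods of p z as a neighborhood base, while near a point outside I the space looks like
  X x Y.  Since p is a homomorphism commuting with the unit operations, continuity and dicontinuity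
  at points of I are inherited from X, and at the other points from X and Y together.  The latter
  works because x outside I forces lambda(x) outside I: otherwise x = lambda(x) x would lie in the
  ideal I.  The statements about right units follow by passing to the opposite semigroups.
*)
theory Submission
  imports Defs
begin

section \<open>Opposite unosemigroups and dicontinuity\<close>

text \<open>An open set of the subspace \<open>l\<close> of \<open>S\<close> is the trace of an open
  \<open>G\<close> of \<open>S\<close>, and each of its points has the form \<open>l a\<close>.
  Quantifying over \<open>a\<close> thus removes both the subspace and \<open>left_quot\<close>, so
  later arguments handle only open sets of \<open>S\<close> itself.\<close>

lemma dicontinuous_leftE:
  assumes "dicontinuous_left S m l" "x \<in> topspace S" "openin S O'" "x \<in> O'"
  obtains U G where "openin S U" "x \<in> U" "openin S G" "l x \<in> G"
    "\<forall>z\<in>topspace S. \<forall>a\<in>topspace S. l a \<in> G \<and> m (l a) z \<in> U \<and> l z \<in> G \<longrightarrow> z \<in> O'"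
proof -
  have "\<exists>U W. openin S U \<and> x \<in> U \<and> openin (subtopology S (l ` topspace S)) W \<and> l x \<in> W \<and>
      left_quot S m W U \<inter> {z \<in> topspace S. l z \<in> W} \<subseteq> O'"
    by (rule assms(1)[unfolded dicontinuous_left_def, THEN bspec, OF assms(2), THEN spec, THEN mp])
      (use assms in simp)
  then obtain U W where UW: "openin S U" "x \<in> U"
    "openin (subtopology S (l ` topspace S)) W" "l x \<in> W"
    "left_quot S m W U \<inter> {z \<in> topspace S. l z \<in> W} \<subseteq> O'"
    by blast
  then obtain G where "openin S G" "W = G \<inter> l ` topspace S"
    by (auto simp: openin_subtopology)
  with UW show ?thesis
    by (intro that[of U G]) (auto simp: left_quot_def)
qed

lemma dicontinuous_leftI:
  assumes "\<And>x O'. \<lbrakk>x \<in> topspace S; openin S O'; x \<in> O'\<rbrakk> \<Longrightarrow>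
    \<exists>U G. openin S U \<and> x \<in> U \<and> openin S G \<and> l x \<in> G \<and>
      (\<forall>z\<in>topspace S. \<forall>a\<in>topspace S. l a \<in> G \<and> m (l a) z \<in> U \<and> l z \<in> G \<longrightarrow> z \<in> O')"
  shows "dicontinuous_left S m l"
  unfolding dicontinuous_left_def
proof (intro ballI allI impI)
  fix x O' assume x: "x \<in> topspace S" "openin S O' \<and> x \<in> O'"
  then obtain U G where UG: "openin S U" "x \<in> U" "openin S G" "l x \<in> G"
    "\<forall>z\<in>topspace S. \<forall>a\<in>topspace S. l a \<in> G \<and> m (l a) z \<in> U \<and> l z \<in> G \<longrightarrow> z \<in> O'"
    using assms[of x O'] by blast
  \<comment> \<open>The trace of \<open>G\<close> on the range of \<open>l\<close> serves as
    \<open>W\<close>; its elements are exactly the \<open>l a\<close> lying in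
    \<open>G\<close>.\<close>
  have "openin (subtopology S (l ` topspace S)) (G \<inter> l ` topspace S)"
    using UG(3) by (rule openin_subtopology_Int)
  moreover have "left_quot S m (G \<inter> l ` topspace S) U \<inter> {z \<in> topspace S. l z \<in> G \<inter> l ` topspace S}
      \<subseteq> O'"
    using UG(5) by (auto simp: left_quot_def)
  ultimately show "\<exists>U W. openin S U \<and> x \<in> U \<and>
      openin (subtopology S (l ` topspace S)) W \<and> l x \<in> W \<and>
      left_quot S m W U \<inter> {z \<in> topspace S. l z \<in> W} \<subseteq> O'"
    using UG x by (intro exI[of _ U] exI[of _ "G \<inter> l ` topspace S"]) blast
qed

text \<open>Reversing the multiplication turns right quotients into left quotients. Every fact about
  right units below is therefore obtained as an instance of one about left units.\<close>

lemma dicontinuous_right_opposite: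
  "dicontinuous_right S m r \<longleftrightarrow> dicontinuous_left S (\<lambda>x y. m y x) r"
  by (simp add: dicontinuous_right_def dicontinuous_left_def right_quot_def left_quot_def)

lemma topological_semigroup_opposite:
  assumes "topological_semigroup S m"
  shows "topological_semigroup S (\<lambda>x y. m y x)"
proof -
  interpret topological_semigroup S m by fact
  have "continuous_map (prod_topology S S) S ((\<lambda>(x, y). m x y) \<circ> (\<lambda>(x, y). (y, x)))"
    by (intro continuous_map_compose[OF _ continuous_mult])
      (simp add: case_prod_unfold continuous_map_fst continuous_map_snd continuous_map_paired)
  moreover have "(\<lambda>(x, y). m x y) \<circ> (\<lambda>(x, y). (y, x)) = (\<lambda>(x, y). m y x)"
    by auto
  ultimately show ?thesis
    using nonempty assoc by unfold_locales auto
qed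

lemma topological_unosemigroup_opposite:
  assumes "topological_unosemigroup S m l r"
  shows "topological_unosemigroup S (\<lambda>x y. m y x) r l"
proof -
  interpret topological_unosemigroup S m l r by fact
  interpret op: topological_semigroup S "\<lambda>x y. m y x"
    by (rule topological_semigroup_opposite) unfold_locales
  show ?thesis
    by unfold_locales (fact continuous_lu continuous_ru left_unit right_unit)+
qed

lemma two_sided_ideal_opposite:
  "two_sided_ideal S (\<lambda>x y. m y x) I \<longleftrightarrow> two_sided_ideal S m I"
  by (simp add: two_sided_ideal_def conj_commute)

text \<open>The topology of the reduced product does not involve the multiplications, so matching
  the operations is what makes left-unit results for the opposite factors readable as right-unit
  results for the reduced product.\<close>

lemma reduced_mult_opposite:
  "(\<lambda>z w. reduced_mult I mX mY w z) = reduced_mult I (\<lambda>x y. mX y x) (\<lambda>x y. mY y x)"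
proof (intro ext)
  fix z w show "reduced_mult I mX mY w z = reduced_mult I (\<lambda>x y. mX y x) (\<lambda>x y. mY y x) z w"
    by (cases z; cases w) auto
qed

section \<open>Closure of the carrier, and ideals under unit operations\<close>

lemma (in topological_semigroup) mult_closed:
  "x \<in> topspace S \<Longrightarrow> y \<in> topspace S \<Longrightarrow> m x y \<in> topspace S"
  using continuous_map_image_subset_topspace[OF continuous_mult] by auto

lemma (in topological_unosemigroup) lu_closed: "x \<in> topspace S \<Longrightarrow> lu x \<in> topspace S"
  using continuous_map_image_subset_topspace[OF continuous_lu] by auto

text \<open>The ideal absorbs \<open>x\<close>, being the product of \<open>lu x\<close> and
  \<open>x\<close>. Contrapositively, \<open>lu\<close> preserves the complement of
  \<open>I\<close>, so units of \<open>Inr\<close> points stay in the carrier.\<close>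

lemma (in topological_unosemigroup) lu_in_ideal_imp:
  "two_sided_ideal S m I \<Longrightarrow> x \<in> topspace S \<Longrightarrow> lu x \<in> I \<Longrightarrow> x \<in> I"
  using left_unit[of x] by (fastforce simp: two_sided_ideal_def)

section \<open>The topology of a reduced product\<close>

text \<open>A total stand-in for the second coordinate. On \<open>Inl\<close> points the value of
  \<open>projr\<close> is unspecified, so continuity is claimed only over the complement of
  \<open>I\<close>.\<close>

definition reduced_snd :: "'a + 'a \<times> 'b \<Rightarrow> 'b" where
  "reduced_snd z = snd (projr z)"

lemma reduced_snd_Inr [simp]: "reduced_snd (Inr (x, y)) = y"
  by (simp add: reduced_snd_def)

lemma reduced_carrier_Inl [simp]: "Inl x \<in> reduced_carrier X Y I \<longleftrightarrow> x \<in> I"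
  by (auto simp: reduced_carrier_def)

lemma reduced_carrier_Inr [simp]:
  "Inr (x, y) \<in> reduced_carrier X Y I \<longleftrightarrow> x \<in> topspace X \<and> x \<notin> I \<and> y \<in> topspace Y"
  by (auto simp: reduced_carrier_def)

lemma reduced_carrier_cases:
  assumes "z \<in> reduced_carrier X Y I"
  obtains (ideal) x where "z = Inl x" "x \<in> I"
    | (pair) x y where "z = Inr (x, y)" "x \<in> topspace X" "x \<notin> I" "y \<in> topspace Y"
  using assms by (auto simp: reduced_carrier_def)

context
  fixes X :: "'a topology" and Y :: "'b topology" and I :: "'a set"
  assumes closed: "closedin X I"
begin

private abbreviation (input) "T \<equiv> reduced_topology X Y I"
private abbreviation (input) "C \<equiv> reduced_carrier X Y I"
private abbreviation (input) "P \<equiv> prod_topology (subtopology X (topspace X - I)) Y"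
private abbreviation (input) "pre V \<equiv> {z \<in> C. reduced_proj z \<in> V}"

section \<open>Open sets and neighborhood bases of the reduced topology\<close>

lemma topspace_reduced [simp]: "topspace T = C"
  using reduced_topology_least(1)[OF closed, of Y] by (simp add: reduced_admissible_def)

lemma continuous_map_reduced_proj: "continuous_map T X reduced_proj"
  using reduced_topology_least(1)[OF closed, of Y] by (simp add: reduced_admissible_def)

lemma openin_reduced_proj_vimage: "openin X V \<Longrightarrow> openin T {z \<in> C. reduced_proj z \<in> V}"
  using openin_continuous_map_preimage[OF continuous_map_reduced_proj] by simp

text \<open>An embedding is open onto its image, and that image is open because it is the preimage
  of the complement of the closed set \<open>I\<close> under the projection.\<close>

lemma openin_reduced_Inr_image:
  assumes "openin P W" shows "openin T (Inr ` W)"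
proof -
  have img: "Inr ` topspace P = pre (topspace X - I)"
    by (auto simp: reduced_carrier_def)
  have op: "openin T (Inr ` topspace P)"
    unfolding img using closed by (intro openin_reduced_proj_vimage) blast
  have "embedding_map P T Inr"
    using reduced_topology_least(1)[OF closed, of Y] by (simp add: reduced_admissible_def)
  then have "open_map P (subtopology T (Inr ` topspace P)) Inr"
    unfolding embedding_map_def by (rule homeomorphic_imp_open_map)
  then have "openin (subtopology T (Inr ` topspace P)) (Inr ` W)"
    using assms unfolding open_map_def by blast
  then show ?thesis using op openin_trans_full by blast
qed

lemma openin_reduced_rectangle:
  assumes "openin X A" "openin Y B"
  shows "openin T (Inr ` ((A - I) \<times> B))"
proof (rule openin_reduced_Inr_image)
  have "A - I = A \<inter> (topspace X - I)" using openin_subset[OF assms(1)] by auto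
  then show "openin P ((A - I) \<times> B)"
    using assms by (simp add: openin_prod_Times_iff openin_subtopology_Int)
qed

text \<open>The sets that admissibility forces to be open. They form a base of a topology that is
  itself admissible, which gives an explicit handle on the reduced topology, defined only as an
  intersection.\<close>

private definition basic :: "('a + 'a \<times> 'b) set \<Rightarrow> bool" where
  "basic U \<longleftrightarrow> (\<exists>V. openin X V \<and> U = pre V) \<or> (\<exists>W. openin P W \<and> U = Inr ` W)"

private lemma basic_Int: assumes "basic U" "basic V" shows "basic (U \<inter> V)"
proof -
  \<comment> \<open>Intersecting with an \<open>Inr\<close> image restricts to the complement of
    \<open>I\<close>, where the preimage of \<open>G\<close> is the rectangle over \<open>G\<close>
    minus \<open>I\<close>; the result is again an \<open>Inr\<close> image.\<close>
  have mixed: "basic (pre G \<inter> Inr ` W)" if "openin X G" "openin P W" for G W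
  proof -
    have "W \<subseteq> topspace P" using that openin_subset by blast
    then have "pre G \<inter> Inr ` W = Inr ` (W \<inter> (G \<inter> (topspace X - I)) \<times> topspace Y)"
      by (auto simp: reduced_carrier_def)
    moreover have "openin P (W \<inter> (G \<inter> (topspace X - I)) \<times> topspace Y)"
      using that by (intro openin_Int) (auto simp: openin_prod_Times_iff openin_subtopology_Int)
    ultimately show ?thesis unfolding basic_def by blast
  qed
  from assms[unfolded basic_def] show ?thesis
  proof (elim disjE exE conjE)
    fix G H assume "openin X G" "U = pre G" "openin X H" "V = pre H"
    then have "openin X (G \<inter> H)" "U \<inter> V = pre (G \<inter> H)" by auto
    then show ?thesis unfolding basic_def by blast
  next
    fix G W assume "openin X G" "U = pre G" "openin P W" "V = Inr ` W"
    then show ?thesis using mixed by simp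
  next
    fix W G assume "openin P W" "U = Inr ` W" "openin X G" "V = pre G"
    then show ?thesis using mixed by (simp add: Int_commute)
  next
    fix W W' assume "openin P W" "U = Inr ` W" "openin P W'" "V = Inr ` W'"
    then have "openin P (W \<inter> W')" "U \<inter> V = Inr ` (W \<inter> W')" by auto
    then show ?thesis unfolding basic_def by blast
  qed
qed

private lemma openin_basic:
  "openin (topology (arbitrary union_of basic)) U \<longleftrightarrow> (\<exists>\<K>. (\<forall>K\<in>\<K>. basic K) \<and> U = \<Union>\<K>)"
proof -
  have "istopology (arbitrary union_of basic)"
    by (intro istopology_base) (rule basic_Int)
  then have "openin (topology (arbitrary union_of basic)) U \<longleftrightarrow> (arbitrary union_of basic) U"
    by (simp only: topology_inverse')
  then show ?thesis
    unfolding union_of_def arbitrary_def by blast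
qed

text \<open>By minimality, every set open in the reduced topology is then a union of basic
  sets.\<close>

private lemma basic_admissible: "reduced_admissible X Y I (topology (arbitrary union_of basic))"
proof -
  let ?B = "topology (arbitrary union_of basic)"
  have bo: "openin ?B U" if "basic U" for U
    unfolding openin_basic using that by (intro exI[of _ "{U}"]) simp
  have sub: "U \<subseteq> C" if "basic U" for U
    using that openin_subset unfolding basic_def by (fastforce simp: reduced_carrier_def)
  have "C = pre (topspace X)"
    using closedin_subset[OF closed] by (auto simp: reduced_carrier_def)
  then have "basic C"
    unfolding basic_def using openin_topspace by blast
  then have "openin ?B C" by (rule bo)
  moreover have "U \<subseteq> C" if "openin ?B U" for U
    using that sub unfolding openin_basic by blast
  ultimately have top: "topspace ?B = C"
    by (meson openin_subset openin_topspace subset_antisym)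
  \<comment> \<open>Preimages commute with unions, so continuity of \<open>Inr\<close> is checked on
    the base first.\<close>
  have vim_basic: "openin P {p \<in> topspace P. Inr p \<in> K}" if "basic K" for K
    using that unfolding basic_def
  proof (elim disjE exE conjE)
    fix V assume V: "openin X V" "K = pre V"
    then have "{p \<in> topspace P. Inr p \<in> K} = (V \<inter> (topspace X - I)) \<times> topspace Y"
      by auto
    with V show ?thesis by (simp add: openin_prod_Times_iff openin_subtopology_Int)
  next
    fix W assume W: "openin P W" "K = Inr ` W"
    then have "{p \<in> topspace P. Inr p \<in> K} = W"
      using openin_subset[OF W(1)] by auto
    with W show ?thesis by simp
  qed
  have vim: "openin P {p \<in> topspace P. Inr p \<in> U}" if U: "openin ?B U" for U
  proof -
    obtain \<K> where \<K>: "\<forall>K\<in>\<K>. basic K" "U = \<Union>\<K>"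
      using U unfolding openin_basic by blast
    have "{p \<in> topspace P. Inr p \<in> U} = \<Union>((\<lambda>K. {p \<in> topspace P. Inr p \<in> K}) ` \<K>)"
      using \<K>(2) by auto
    also have "openin P \<dots>"
      using \<K>(1) vim_basic by (intro openin_Union) auto
    finally show ?thesis .
  qed
  have "embedding_map P ?B Inr"
  proof (rule injective_open_imp_embedding_map)
    show "continuous_map P ?B Inr"
      unfolding continuous_map_def top using vim by (auto simp: reduced_carrier_def)
    show "open_map P ?B Inr"
      unfolding open_map_def using bo unfolding basic_def by blast
  qed auto
  moreover have "continuous_map ?B X reduced_proj"
    unfolding continuous_map_def top
  proof (intro conjI allI impI)
    show "reduced_proj \<in> C \<rightarrow> topspace X"
      using closedin_subset[OF closed] by (auto simp: reduced_carrier_def)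
    show "openin ?B (pre V)" if "openin X V" for V
      using that by (intro bo) (auto simp: basic_def)
  qed
  ultimately show ?thesis by (simp add: reduced_admissible_def top)
qed

text \<open>A basic set containing \<open>Inl x\<close> cannot be an \<open>Inr\<close> image, hence
  it is the preimage of an open set of \<open>X\<close>.\<close>

lemma reduced_nbhd_Inl:
  assumes "openin T U" "Inl x \<in> U"
  obtains V where "openin X V" "x \<in> V" "{z \<in> C. reduced_proj z \<in> V} \<subseteq> U"
proof -
  have "openin (topology (arbitrary union_of basic)) U"
    using reduced_topology_least(2)[OF closed basic_admissible assms(1)] .
  then obtain K where "basic K" "Inl x \<in> K" "K \<subseteq> U"
    using assms(2) unfolding openin_basic by blast
  then show ?thesis using that unfolding basic_def by auto
qed

text \<open>Continuity of \<open>Inr\<close> yields a box around the point in the product; its first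
  side is open in \<open>X\<close> because the complement of \<open>I\<close> is open.\<close>

lemma reduced_nbhd_Inr:
  assumes "openin T U" "Inr (x, y) \<in> U"
  obtains A B where "openin X A" "x \<in> A" "A \<subseteq> topspace X - I" "openin Y B" "y \<in> B"
    "Inr ` (A \<times> B) \<subseteq> U"
proof -
  have "embedding_map P T Inr"
    using reduced_topology_least(1)[OF closed, of Y] by (simp add: reduced_admissible_def)
  then have "continuous_map P T Inr"
    unfolding embedding_map_def
    by (intro continuous_map_into_fulltopology[OF homeomorphic_imp_continuous_map])
  then have op: "openin P {p \<in> topspace P. Inr p \<in> U}"
    using assms(1) by (rule openin_continuous_map_preimage)
  have "Inr (x, y) \<in> C" using assms openin_subset by fastforce
  then have "(x, y) \<in> {p \<in> topspace P. Inr p \<in> U}" using assms(2) by simp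
  then obtain A B where AB: "openin (subtopology X (topspace X - I)) A" "openin Y B"
      "x \<in> A" "y \<in> B" "A \<times> B \<subseteq> {p \<in> topspace P. Inr p \<in> U}"
    using op unfolding openin_prod_topology_alt by meson
  moreover have "openin X (topspace X - I)" using closed by blast
  ultimately have "openin X A" "A \<subseteq> topspace X - I"
    using openin_open_subtopology by blast+
  with AB show ?thesis by (intro that[of A B]) auto
qed

section \<open>Continuity out of and into the reduced product\<close>

lemma continuous_map_reduced_snd:
  "continuous_map (subtopology T {z \<in> C. reduced_proj z \<notin> I}) Y reduced_snd"
  unfolding continuous_map_def
proof (intro conjI allI impI)
  show "reduced_snd \<in> topspace (subtopology T {z \<in> C. reduced_proj z \<notin> I}) \<rightarrow> topspace Y"
    by (auto elim!: reduced_carrier_cases)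
  fix B assume B: "openin Y B"
  have "{z \<in> topspace (subtopology T {z \<in> C. reduced_proj z \<notin> I}). reduced_snd z \<in> B}
      = Inr ` ((topspace X - I) \<times> B) \<inter> {z \<in> C. reduced_proj z \<notin> I}"
    using openin_subset[OF B] by (auto simp: image_iff elim!: reduced_carrier_cases)
  then show "openin (subtopology T {z \<in> C. reduced_proj z \<notin> I})
      {z \<in> topspace (subtopology T {z \<in> C. reduced_proj z \<notin> I}). reduced_snd z \<in> B}"
    using openin_reduced_rectangle[OF openin_topspace B] by (simp add: openin_subtopology_Int)
qed

text \<open>At a point sent into \<open>I\<close>, neighborhoods of the image are preimages under
  the projection, so the first coordinate alone decides. Elsewhere the neighborhoods are boxes, and
  both coordinates are controlled on an open part of \<open>Z\<close>.\<close>

lemma continuous_map_into_reduced: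
  assumes im: "f \<in> topspace Z \<rightarrow> C"
    and proj: "continuous_map Z X (\<lambda>z. reduced_proj (f z))"
    and snd: "continuous_map (subtopology Z {z \<in> topspace Z. reduced_proj (f z) \<notin> I}) Y
               (\<lambda>z. reduced_snd (f z))"
  shows "continuous_map Z T f"
  unfolding continuous_map_def
proof (intro conjI allI impI)
  show "f \<in> topspace Z \<rightarrow> topspace T" using im by simp
  fix U assume U: "openin T U"
  let ?D = "{z \<in> topspace Z. reduced_proj (f z) \<notin> I}"
  have "openin X (topspace X - I)" using closed by blast
  from openin_continuous_map_preimage[OF proj this]
  \<comment> \<open>\<open>?D\<close> is the preimage of the open complement of \<open>I\<close>.
    Its openness later turns sets open in the subspace \<open>?D\<close> into sets open in
    \<open>Z\<close>.\<close>
  have D: "openin Z ?D"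
    by (rule back_subst[of "openin Z"]) (use continuous_map_funspace[OF proj] in auto)
  show "openin Z {z \<in> topspace Z. f z \<in> U}"
  proof (subst openin_subopen, intro ballI)
    fix z assume "z \<in> {z \<in> topspace Z. f z \<in> U}"
    then have z: "z \<in> topspace Z" "f z \<in> U" by auto
    show "\<exists>N. openin Z N \<and> z \<in> N \<and> N \<subseteq> {z \<in> topspace Z. f z \<in> U}"
    proof (cases "f z")
      case (Inl x)
      then have "Inl x \<in> U" using z by simp
      with U obtain V where V: "openin X V" "x \<in> V" "pre V \<subseteq> U"
        by (rule reduced_nbhd_Inl)
      have "openin Z {z \<in> topspace Z. reduced_proj (f z) \<in> V}"
        using proj V(1) by (rule openin_continuous_map_preimage)
      then show ?thesis using z V Inl im
        by (intro exI[of _ "{z \<in> topspace Z. reduced_proj (f z) \<in> V}"]) auto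
    next
      case (Inr p)
      then obtain x y where xy: "f z = Inr (x, y)" by (cases p) auto
      then have "Inr (x, y) \<in> U" using z by simp
      with U obtain A B where AB: "openin X A" "x \<in> A" "A \<subseteq> topspace X - I" "openin Y B" "y \<in> B"
          "Inr ` (A \<times> B) \<subseteq> U"
        by (rule reduced_nbhd_Inr)
      \<comment> \<open>The second coordinate is constrained only inside \<open>?D\<close>, where it
        is continuous. Since \<open>A\<close> misses \<open>I\<close>, the point \<open>z\<close>
        lies in \<open>?D\<close> and \<open>f\<close> takes only \<open>Inr\<close> values on
        \<open>?N\<close>.\<close>
      let ?N = "{z \<in> topspace (subtopology Z ?D). reduced_snd (f z) \<in> B}
                \<inter> {z \<in> topspace Z. reduced_proj (f z) \<in> A}"
      have "openin (subtopology Z ?D) {z \<in> topspace (subtopology Z ?D). reduced_snd (f z) \<in> B}"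
        using snd AB(4) by (rule openin_continuous_map_preimage)
      then have "openin Z ?N"
        using openin_continuous_map_preimage[OF proj AB(1)] openin_trans_full[OF _ D] by blast
      moreover have "z \<in> ?N" using z xy AB by auto
      moreover have "f w \<in> U" if "w \<in> ?N" for w
      proof -
        have "f w \<in> C" using im that by auto
        then show ?thesis using that AB(3,6) by (cases rule: reduced_carrier_cases) auto
      qed
      ultimately show ?thesis by (intro exI[of _ ?N]) auto
    qed
  qed
qed

end

section \<open>Operations on a reduced product\<close>

lemma reduced_proj_closed:
  "I \<subseteq> topspace X \<Longrightarrow> z \<in> reduced_carrier X Y I \<Longrightarrow> reduced_proj z \<in> topspace X"
  by (erule reduced_carrier_cases) auto

lemma reduced_proj_mult:
  "reduced_proj (reduced_mult I mX mY z w) = mX (reduced_proj z) (reduced_proj w)"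
  by (cases z; cases w) (auto simp: reduced_quot_def)

lemma reduced_proj_unit: "reduced_proj (reduced_unit uX uY z) = uX (reduced_proj z)"
  by (cases z) auto

lemma reduced_mult_closed:
  assumes "topological_semigroup X mX" "topological_semigroup Y mY" "two_sided_ideal X mX I"
    and "z \<in> reduced_carrier X Y I" "w \<in> reduced_carrier X Y I"
  shows "reduced_mult I mX mY z w \<in> reduced_carrier X Y I"
  using assms(3-5)
  by (auto elim!: reduced_carrier_cases simp: reduced_quot_def two_sided_ideal_def subset_iff
      topological_semigroup.mult_closed[OF assms(1)] topological_semigroup.mult_closed[OF assms(2)])

text \<open>The carrier is the image of the full product under the homomorphism
  \<open>reduced_quot\<close>, so associativity is inherited from the factors without a case split
  on the constructors.\<close>

lemma reduced_mult_assoc: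
  assumes "topological_semigroup X mX" "topological_semigroup Y mY" "two_sided_ideal X mX I"
    and "u \<in> reduced_carrier X Y I" "v \<in> reduced_carrier X Y I" "w \<in> reduced_carrier X Y I"
  shows "reduced_mult I mX mY (reduced_mult I mX mY u v) w
       = reduced_mult I mX mY u (reduced_mult I mX mY v w)"
proof -
  interpret X: topological_semigroup X mX by fact
  interpret Y: topological_semigroup Y mY by fact
  have I: "I \<subseteq> topspace X" using assms(3) by (simp add: two_sided_ideal_def)
  have hom: "reduced_mult I mX mY (reduced_quot I (a, b)) (reduced_quot I (a', b'))
      = reduced_quot I (mX a a', mY b b')"
    if "a \<in> topspace X" "b \<in> topspace Y" "a' \<in> topspace X" "b' \<in> topspace Y" for a b a' b'
    using reduced_mult_hom[OF assms(3), of "(a, b)" Y "(a', b')"] that by simp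
  have "u \<in> reduced_quot I ` (topspace X \<times> topspace Y)"
    "v \<in> reduced_quot I ` (topspace X \<times> topspace Y)"
    "w \<in> reduced_quot I ` (topspace X \<times> topspace Y)"
    using assms(4-6) reduced_quot_image[OF I Y.nonempty] by auto
  then show ?thesis
    by (auto simp: hom X.mult_closed Y.mult_closed X.assoc Y.assoc)
qed

lemma continuous_map_reduced_mult:
  assumes X: "topological_semigroup X mX" and Y: "topological_semigroup Y mY"
    and I: "closedin X I" "two_sided_ideal X mX I"
  shows "continuous_map (prod_topology (reduced_topology X Y I) (reduced_topology X Y I))
           (reduced_topology X Y I) (\<lambda>(z, w). reduced_mult I mX mY z w)"
proof (rule continuous_map_into_reduced[OF I(1)])
  let ?T = "reduced_topology X Y I" and ?C = "reduced_carrier X Y I"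
  let ?E = "{z \<in> ?C. reduced_proj z \<notin> I}"
  let ?TT = "prod_topology ?T ?T" and ?f = "\<lambda>(z, w). reduced_mult I mX mY z w"
  let ?D = "{p \<in> topspace ?TT. reduced_proj (?f p) \<notin> I}"
  interpret X: topological_semigroup X mX by fact
  interpret Y: topological_semigroup Y mY by fact
  have top: "topspace ?T = ?C" using I(1) by simp
  show "?f \<in> topspace ?TT \<rightarrow> ?C"
    using reduced_mult_closed[OF X Y I(2)] by (auto simp: top)
  have "continuous_map ?TT X ((\<lambda>(x, y). mX x y) \<circ> (\<lambda>p. (reduced_proj (fst p), reduced_proj (snd p))))"
    by (intro continuous_map_compose[OF _ X.continuous_mult] continuous_map_paired[THEN iffD2] conjI
      continuous_map_compose[OF continuous_map_fst continuous_map_reduced_proj[OF I(1)], unfolded o_def]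
      continuous_map_compose[OF continuous_map_snd continuous_map_reduced_proj[OF I(1)], unfolded o_def])
  then show "continuous_map ?TT X (\<lambda>p. reduced_proj (?f p))"
    by (simp add: o_def case_prod_unfold reduced_proj_mult)
  \<comment> \<open>A product outside the ideal has both factors outside it. Hence both second
    coordinates vary continuously on \<open>?D\<close>.\<close>
  have D: "fst p \<in> ?E \<and> snd p \<in> ?E" if "p \<in> ?D" for p
    using that I(2) reduced_proj_closed[of I X _ Y]
    by (auto simp: top reduced_proj_mult two_sided_ideal_def case_prod_unfold)
  have "continuous_map (subtopology ?TT ?D) (subtopology ?T ?E) fst"
    "continuous_map (subtopology ?TT ?D) (subtopology ?T ?E) snd"
    using D by (auto simp: continuous_map_in_subtopology continuous_map_from_subtopology
        continuous_map_fst continuous_map_snd image_subset_iff)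
  note this[THEN continuous_map_compose, OF continuous_map_reduced_snd[OF I(1)], unfolded o_def]
  then have "continuous_map (subtopology ?TT ?D) Y
      ((\<lambda>(x, y). mY x y) \<circ> (\<lambda>p. (reduced_snd (fst p), reduced_snd (snd p))))"
    by (intro continuous_map_compose[OF _ Y.continuous_mult] continuous_map_paired[THEN iffD2] conjI)
  then show "continuous_map (subtopology ?TT ?D) Y (\<lambda>p. reduced_snd (?f p))"
  \<comment> \<open>On \<open>?D\<close> the quotient map does not collapse the product, so its
    second coordinate really is the product in \<open>Y\<close>.\<close>
  proof (rule continuous_map_eq)
    fix p assume "p \<in> topspace (subtopology ?TT ?D)"
    then have p: "p \<in> ?D" by simp
    then show "((\<lambda>(x, y). mY x y) \<circ> (\<lambda>p. (reduced_snd (fst p), reduced_snd (snd p)))) p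
        = reduced_snd (?f p)"
      using D[OF p]
      by (cases p) (auto simp: reduced_quot_def elim!: reduced_carrier_cases split: if_splits)
  qed
qed

section \<open>The unosemigroup structure of the reduced product\<close>

lemma topological_semigroup_reduced:
  assumes X: "topological_semigroup X mX" and Y: "topological_semigroup Y mY"
    and I: "closedin X I" "two_sided_ideal X mX I"
  shows "topological_semigroup (reduced_topology X Y I) (reduced_mult I mX mY)"
proof
  have "I \<subseteq> topspace X" using I(2) by (simp add: two_sided_ideal_def)
  moreover have "topspace X \<times> topspace Y \<noteq> {}"
    using topological_semigroup.nonempty[OF X] topological_semigroup.nonempty[OF Y] by simp
  ultimately have "reduced_carrier X Y I \<noteq> {}"
    using reduced_quot_image[OF _ topological_semigroup.nonempty[OF Y]] image_is_empty by blast
  then show "topspace (reduced_topology X Y I) \<noteq> {}" using I(1) by simp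
qed (use continuous_map_reduced_mult[OF assms] reduced_mult_assoc[OF X Y I(2)] I(1) in auto)

lemma reduced_unit_closed:
  assumes "topological_unosemigroup X mX lX rX" "topological_unosemigroup Y mY lY rY"
    and "two_sided_ideal X mX I" "lX ` I \<subseteq> I" "z \<in> reduced_carrier X Y I"
  shows "reduced_unit lX lY z \<in> reduced_carrier X Y I"
proof -
  interpret X: topological_unosemigroup X mX lX rX by fact
  interpret Y: topological_unosemigroup Y mY lY rY by fact
  from assms(5) show ?thesis
    using assms(4) X.lu_closed Y.lu_closed X.lu_in_ideal_imp[OF assms(3)]
    by (cases rule: reduced_carrier_cases) auto
qed

lemma continuous_map_reduced_unit:
  assumes X: "topological_unosemigroup X mX lX rX" and Y: "topological_unosemigroup Y mY lY rY"
    and I: "closedin X I" "two_sided_ideal X mX I" "lX ` I \<subseteq> I"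
  shows "continuous_map (reduced_topology X Y I) (reduced_topology X Y I) (reduced_unit lX lY)"
proof (rule continuous_map_into_reduced[OF I(1)])
  let ?T = "reduced_topology X Y I" and ?C = "reduced_carrier X Y I"
  let ?D = "{z \<in> topspace ?T. reduced_proj (reduced_unit lX lY z) \<notin> I}"
  let ?E = "{z \<in> ?C. reduced_proj z \<notin> I}"
  interpret X: topological_unosemigroup X mX lX rX by fact
  interpret Y: topological_unosemigroup Y mY lY rY by fact
  show "reduced_unit lX lY \<in> topspace ?T \<rightarrow> ?C"
    using reduced_unit_closed[OF X Y I(2,3)] I(1) by auto
  show "continuous_map ?T X (\<lambda>z. reduced_proj (reduced_unit lX lY z))"
    using continuous_map_compose[OF continuous_map_reduced_proj[OF I(1)] X.continuous_lu]
    by (simp add: o_def reduced_proj_unit)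
  \<comment> \<open>As \<open>lX\<close> maps \<open>I\<close> into \<open>I\<close>, a point whose
    unit projects outside \<open>I\<close> itself projects outside \<open>I\<close>.\<close>
  have "?D \<subseteq> ?E" using I by (auto simp: reduced_proj_unit)
  then have "continuous_map (subtopology ?T ?D) Y reduced_snd"
    using continuous_map_reduced_snd[OF I(1)] continuous_map_from_subtopology_mono by blast
  from continuous_map_compose[OF this Y.continuous_lu]
  show "continuous_map (subtopology ?T ?D) Y (\<lambda>z. reduced_snd (reduced_unit lX lY z))"
    by (rule continuous_map_eq) (use I in \<open>auto elim!: reduced_carrier_cases\<close>)
qed

lemma reduced_left_unit:
  assumes "topological_unosemigroup X mX lX rX" "topological_unosemigroup Y mY lY rY"
    and "two_sided_ideal X mX I" "z \<in> reduced_carrier X Y I"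
  shows "reduced_mult I mX mY (reduced_unit lX lY z) z = z"
proof -
  interpret X: topological_unosemigroup X mX lX rX by fact
  interpret Y: topological_unosemigroup Y mY lY rY by fact
  from assms(4) show ?thesis
    using assms(3) X.left_unit Y.left_unit
    by (cases rule: reduced_carrier_cases) (auto simp: reduced_quot_def two_sided_ideal_def)
qed

lemma topological_unosemigroup_reduced:
  assumes X: "topological_unosemigroup X mX lX rX" and Y: "topological_unosemigroup Y mY lY rY"
    and I: "closedin X I" "two_sided_ideal X mX I" "lX ` I \<subseteq> I" "rX ` I \<subseteq> I"
  shows "topological_unosemigroup (reduced_topology X Y I) (reduced_mult I mX mY)
           (reduced_unit lX lY) (reduced_unit rX rY)"
proof -
  \<comment> \<open>In the opposite factors \<open>rX\<close> and \<open>rY\<close> are left unit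
    operations, so the left-unit lemmas cover them.\<close>
  note X' = topological_unosemigroup_opposite[OF X] and Y' = topological_unosemigroup_opposite[OF Y]
  have I': "two_sided_ideal X (\<lambda>x y. mX y x) I" using I(2) by (rule two_sided_ideal_opposite[THEN iffD2])
  interpret topological_semigroup "reduced_topology X Y I" "reduced_mult I mX mY"
    using topological_semigroup_reduced[OF topological_unosemigroup.axioms(1)[OF X]
        topological_unosemigroup.axioms(1)[OF Y] I(1,2)] .
  show ?thesis
  proof
    fix z assume "z \<in> topspace (reduced_topology X Y I)"
    then have z: "z \<in> reduced_carrier X Y I" using I(1) by simp
    show "reduced_mult I mX mY (reduced_unit lX lY z) z = z"
      using reduced_left_unit[OF X Y I(2) z] .
    show "reduced_mult I mX mY z (reduced_unit rX rY z) = z"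
      using reduced_left_unit[OF X' Y' I' z] by (subst (asm) reduced_mult_opposite[symmetric])
  qed (intro continuous_map_reduced_unit[OF X Y] continuous_map_reduced_unit[OF X' Y'] I I')+
qed

section \<open>Dicontinuity of the unit operations\<close>

lemma dicontinuous_left_reduced:
  assumes X: "topological_unosemigroup X mX lX rX" and Y: "topological_unosemigroup Y mY lY rY"
    and I: "closedin X I" "two_sided_ideal X mX I" "lX ` I \<subseteq> I"
    and dX: "dicontinuous_left X mX lX" and dY: "dicontinuous_left Y mY lY"
  shows "dicontinuous_left (reduced_topology X Y I) (reduced_mult I mX mY) (reduced_unit lX lY)"
proof (rule dicontinuous_leftI)
  let ?T = "reduced_topology X Y I" and ?C = "reduced_carrier X Y I"
  let ?m = "reduced_mult I mX mY" and ?l = "reduced_unit lX lY"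
  interpret X: topological_unosemigroup X mX lX rX by fact
  interpret Y: topological_unosemigroup Y mY lY rY by fact
  have IX: "I \<subseteq> topspace X" using I(2) by (simp add: two_sided_ideal_def)
  have top: "topspace ?T = ?C" using I(1) by simp
  fix z O' assume "z \<in> topspace ?T" and O': "openin ?T O'" "z \<in> O'"
  then have z: "z \<in> ?C" by (simp add: top)
  then show "\<exists>U G. openin ?T U \<and> z \<in> U \<and> openin ?T G \<and> ?l z \<in> G \<and>
      (\<forall>w\<in>topspace ?T. \<forall>a\<in>topspace ?T. ?l a \<in> G \<and> ?m (?l a) w \<in> U \<and> ?l w \<in> G \<longrightarrow> w \<in> O')"
  proof (cases rule: reduced_carrier_cases)
    case (ideal x)
    obtain V where V: "openin X V" "x \<in> V" "{z \<in> ?C. reduced_proj z \<in> V} \<subseteq> O'"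
      by (rule reduced_nbhd_Inl[OF I(1) O'[unfolded ideal(1)]])
    have "x \<in> topspace X" using ideal IX by auto
    obtain U G where UG: "openin X U" "x \<in> U" "openin X G" "lX x \<in> G"
      "\<forall>z\<in>topspace X. \<forall>a\<in>topspace X. lX a \<in> G \<and> mX (lX a) z \<in> U \<and> lX z \<in> G \<longrightarrow> z \<in> V"
      by (rule dicontinuous_leftE[OF dX \<open>x \<in> topspace X\<close> V(1,2)])
    \<comment> \<open>Preimages under the projection suffice: the projection is a homomorphism
      commuting with the units, so the hypotheses on \<open>w\<close> and \<open>a\<close> descend
      to \<open>X\<close>.\<close>
    let ?U = "{z \<in> ?C. reduced_proj z \<in> U}" and ?G = "{z \<in> ?C. reduced_proj z \<in> G}"
    have "w \<in> O'" if "w \<in> ?C" "a \<in> ?C" "?l a \<in> ?G" "?m (?l a) w \<in> ?U" "?l w \<in> ?G" for w a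
    proof -
      have "reduced_proj w \<in> topspace X" "reduced_proj a \<in> topspace X"
        using reduced_proj_closed[OF IX] that(1,2) by blast+
      moreover have "lX (reduced_proj a) \<in> G" "mX (lX (reduced_proj a)) (reduced_proj w) \<in> U"
        "lX (reduced_proj w) \<in> G"
        using that(3-5) by (simp_all add: reduced_proj_mult reduced_proj_unit)
      ultimately have "reduced_proj w \<in> V" using UG(5) by blast
      then show ?thesis using V(3) that(1) by blast
    qed
    moreover have "z \<in> ?U" "?l z \<in> ?G" using ideal UG I(3) by auto
    ultimately show ?thesis
      using openin_reduced_proj_vimage[OF I(1)] UG(1,3)
      by (simp only: top) (rule exI[of _ ?U], rule exI[of _ ?G], blast)
  next
    case (pair x y)
    obtain A B where AB: "openin X A" "x \<in> A" "openin Y B" "y \<in> B" "Inr ` (A \<times> B) \<subseteq> O'"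
      by (rule reduced_nbhd_Inr[OF I(1) O'[unfolded pair(1)]])
    obtain U G where UG: "openin X U" "x \<in> U" "openin X G" "lX x \<in> G"
      "\<forall>z\<in>topspace X. \<forall>a\<in>topspace X. lX a \<in> G \<and> mX (lX a) z \<in> U \<and> lX z \<in> G \<longrightarrow> z \<in> A"
      by (rule dicontinuous_leftE[OF dX pair(2) AB(1,2)])
    obtain U' G' where UG': "openin Y U'" "y \<in> U'" "openin Y G'" "lY y \<in> G'"
      "\<forall>z\<in>topspace Y. \<forall>a\<in>topspace Y. lY a \<in> G' \<and> mY (lY a) z \<in> U' \<and> lY z \<in> G' \<longrightarrow> z \<in> B"
      by (rule dicontinuous_leftE[OF dY pair(4) AB(3,4)])
    \<comment> \<open>Removing \<open>I\<close> keeps the rectangles inside the carrier. Since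
      \<open>reduced_unit\<close> preserves constructors, having units in \<open>?G\<close> forces
      \<open>w\<close> and \<open>a\<close> to be \<open>Inr\<close> pairs.\<close>
    let ?U = "Inr ` ((U - I) \<times> U')" and ?G = "Inr ` ((G - I) \<times> G')"
    have "w \<in> O'" if w: "w \<in> ?C" and a: "a \<in> ?C"
      and h: "?l a \<in> ?G" "?m (?l a) w \<in> ?U" "?l w \<in> ?G" for w a
    proof -
      obtain w1 w2 where w': "w = Inr (w1, w2)" "w1 \<in> topspace X" "w2 \<in> topspace Y"
        using w h(3) by (auto elim: reduced_carrier_cases)
      obtain a1 a2 where a': "a = Inr (a1, a2)" "a1 \<in> topspace X" "a2 \<in> topspace Y"
        using a h(1) by (auto elim: reduced_carrier_cases)
      \<comment> \<open>Membership in \<open>?U\<close> rules out the collapsing branch of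
        \<open>reduced_quot\<close>, so the conditions split into one for \<open>X\<close> and one
        for \<open>Y\<close>.\<close>
      have "w1 \<in> A" "w2 \<in> B"
        using h w' a' UG(5) UG'(5) by (auto simp: reduced_quot_def split: if_splits)
      then show ?thesis using AB(5) w' by auto
    qed
    \<comment> \<open>That \<open>?l z\<close> lies in \<open>?G\<close> needs \<open>lX x\<close>
      outside \<open>I\<close>, which follows from absorption because \<open>x\<close> is outside
      \<open>I\<close>.\<close>
    moreover have "z \<in> ?U" "?l z \<in> ?G"
      using pair UG UG' X.lu_in_ideal_imp[OF I(2)] by auto
    ultimately show ?thesis
      using openin_reduced_rectangle[OF I(1)] UG(1,3) UG'(1,3)
      by (simp only: top) (rule exI[of _ ?U], rule exI[of _ ?G], blast)
  qed
qed

theorem corollary3: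
  fixes X :: "'a topology" and Y :: "'b topology"
    and mX lX rX and mY lY rY and I :: "'a set"
  assumes "topological_unosemigroup X mX lX rX"
    and "topological_unosemigroup Y mY lY rY"
    and "closedin X I"
    and "two_sided_ideal X mX I"
    and "lX ` I \<union> rX ` I \<subseteq> I"
    and "ditopological_unosemigroup X mX lX rX"
    and "ditopological_unosemigroup Y mY lY rY"
  shows "ditopological_unosemigroup (reduced_topology X Y I) (reduced_mult I mX mY)
           (reduced_unit lX lY) (reduced_unit rX rY)"
proof -
  interpret X: ditopological_unosemigroup X mX lX rX by fact
  interpret Y: ditopological_unosemigroup Y mY lY rY by fact
  have I: "lX ` I \<subseteq> I" "rX ` I \<subseteq> I" using assms(5) by auto
  interpret topological_unosemigroup "reduced_topology X Y I" "reduced_mult I mX mY"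
    "reduced_unit lX lY" "reduced_unit rX rY"
    using topological_unosemigroup_reduced[OF assms(1-4) I] .
  show ?thesis
  proof
    show "dicontinuous_left (reduced_topology X Y I) (reduced_mult I mX mY) (reduced_unit lX lY)"
      using dicontinuous_left_reduced[OF assms(1-4) I(1) X.dicontinuous_lu Y.dicontinuous_lu] .
    have "two_sided_ideal X (\<lambda>x y. mX y x) I"
      using assms(4) by (rule two_sided_ideal_opposite[THEN iffD2])
    \<comment> \<open>The left-unit result is applied to the opposite factors, with
      \<open>rX\<close> and \<open>rY\<close> as left units; rewriting the opposite multiplication
      then gives the right-hand condition.\<close>
    from dicontinuous_left_reduced[OF topological_unosemigroup_opposite[OF assms(1)]
        topological_unosemigroup_opposite[OF assms(2)] assms(3) this I(2)
        X.dicontinuous_ru[unfolded dicontinuous_right_opposite]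
        Y.dicontinuous_ru[unfolded dicontinuous_right_opposite]]
    show "dicontinuous_right (reduced_topology X Y I) (reduced_mult I mX mY) (reduced_unit rX rY)"
      by (subst dicontinuous_right_opposite, subst reduced_mult_opposite)
  qed
qed

end
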